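(* Let $T$ be a tree on $n$ vertices with fixed diameter $D$ ($D\ge 3$). Then $$\frac{n}{2\lceil \frac n2\rceil\lfloor \frac n2\rfloor}\le b(T)\le \frac{n}{2\lceil \frac D2\rceil\left(n-\lceil \frac D2\rceil\right)}.$$ Moreover, both bounds are sharp.
   Context: Graphs are finite, simple, undirected and unweighted. For a graph $G$ with vertex set $V(G)$ and edge set $E(G)$, the $\ell_1$-Fiedler value is $$b(G)=\min\Big\{\sum_{uv\in E(G)}|x_u-x_v| : x\in\mathbb{R}^{V(G)},\ \sum_{v\in V(G)}x_v=0,\ \sum_{v\in V(G)}|x_v|=1\Big\}.$$ The diameter is the maximum distance (number of edges of a shortest path) between two vertices. *)

theory Defs
  imports "Graph_Theory.Graph_Theory"
begin

text \<open>
  A finite simple undirected graph is a \<^locale>\<open>pair_graph\<close>: every edge \<open>uv\<close> is represented by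
  the two arcs \<open>(u, v)\<close> and \<open>(v, u)\<close>.

  The predicate \<open>tree\<close> of the library is meant for directed graphs: in a symmetric digraph, going
  back and forth along one edge is a \<open>cycle\<close> of length 2.  The cycles of the underlying
  undirected graph are those of length at least 3.
\<close>

definition tree_graph :: "'a pair_pre_digraph \<Rightarrow> bool" where
  "tree_graph G \<longleftrightarrow>
     pair_graph G \<and> Digraph_Component.connected (with_proj G) \<and>
     \<not> (\<exists>p. pre_digraph.cycle (with_proj G) p \<and> length p \<ge> 3)"

text \<open>Distance and diameter are only meaningful for (nonempty, finite) connected graphs.\<close>

definition graph_dist :: "'a pair_pre_digraph \<Rightarrow> 'a \<Rightarrow> 'a \<Rightarrow> nat" where
  "graph_dist G u v = (LEAST k. \<exists>p. pre_digraph.apath (with_proj G) u p v \<and> length p = k)"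

definition graph_diameter :: "'a pair_pre_digraph \<Rightarrow> nat" where
  "graph_diameter G = Max {graph_dist G u v | u v. u \<in> pverts G \<and> v \<in> pverts G}"

text \<open>The factor \<open>1/2\<close> compensates for each edge being counted as two arcs.\<close>

definition edge_variation :: "'a pair_pre_digraph \<Rightarrow> ('a \<Rightarrow> real) \<Rightarrow> real" where
  "edge_variation G x = (\<Sum>(u, v)\<in>parcs G. \<bar>x u - x v\<bar>) / 2"

text \<open>
  On the reals, \<open>LEAST m. P m\<close> is the minimum of \<open>{m. P m}\<close>, and unspecified if there is none.
  Vectors indexed by the vertices are functions on the whole type, of which only the values on
  \<open>pverts G\<close> matter.
\<close>

definition l1_fiedler :: "'a pair_pre_digraph \<Rightarrow> real" where
  "l1_fiedler G =
     (LEAST m. \<exists>x :: 'a \<Rightarrow> real.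
        (\<Sum>v\<in>pverts G. x v) = 0 \<and> (\<Sum>v\<in>pverts G. \<bar>x v\<bar>) = 1 \<and> m = edge_variation G x)"

end

theory Submission
  imports Defs
begin

text \<open>
  Deleting an edge \<open>e\<close> of a tree on \<open>n\<close> vertices leaves a side with \<open>s(e)\<close> vertices and one with
  \<open>n - s(e)\<close>.  If \<open>x\<close> sums to \<open>0\<close>, then \<open>n \<bar>x u\<bar> \<le> (\<Sum>v. \<bar>x u - x v\<bar>)\<close> for each \<open>u\<close>.  On the
  other hand \<open>\<bar>x u - x v\<bar>\<close> is at most the variation of \<open>x\<close> along the path from \<open>u\<close> to \<open>v\<close>, which
  consists of edges separating \<open>u\<close> from \<open>v\<close>, and \<open>e\<close> separates \<open>s(e) (n - s(e))\<close> unordered pairs.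
  Summing over all pairs bounds the variation of a normalised \<open>x\<close> from below by \<open>n / (2 M)\<close>, where
  \<open>M\<close> is the maximum of \<open>s(e) (n - s(e))\<close>; a vector constant on both sides of an optimal edge
  attains this value.  So \<open>b(T) = n / (2 M)\<close>.  Now \<open>M\<close> is largest if some edge splits \<open>T\<close> evenly, and
  the middle edge of a diametral path has at least \<open>\<lceil>D/2\<rceil>\<close> vertices on both sides.  Both bounds
  are attained by a path with \<open>D + 1\<close> vertices and pendant vertices attached to inner vertices of the
  path: to the first and the last one so as to balance the middle edge, respectively all to a middle one.
\<close>

section \<open>Walks, paths and distances\<close>

text \<open>Cutting out closed subwalks introduces no new arcs. That \<open>q\<close> stays inside
  \<open>set p\<close> matters when \<open>p\<close> avoids a given edge.\<close>

lemma (in wf_digraph) awalk_shorten: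
  assumes "awalk u p v"
  shows "\<exists>q. apath u q v \<and> set q \<subseteq> set p \<and> length q \<le> length p"
  using assms
proof (induct rule: awalk_to_apath_induct)
  case (path p)
  then show ?case by (auto simp: apath_def)
next
  case (decomp p q r s)
  have "p = q @ r @ s"
    using awalk_cyc_decompE[OF decomp(2,1,3)] by blast
  with decomp(4) show ?case by fastforce
qed

lemma (in pair_wf_digraph) graph_dist_le:
  assumes "awalk u p v"
  shows "graph_dist G u v \<le> length p"
proof -
  obtain q where q: "apath u q v" "length q \<le> length p"
    using awalk_shorten[OF assms] by auto
  have "graph_dist G u v \<le> length q"
    unfolding graph_dist_def by (rule Least_le) (use q in blast)
  with q show ?thesis by simp
qed

lemma (in pair_wf_digraph) graph_dist_apath:
  assumes "apath u p v"
  obtains q where "apath u q v" "length q = graph_dist G u v"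
proof -
  have "\<exists>q. apath u q v \<and> length q = graph_dist G u v"
    unfolding graph_dist_def by (rule LeastI_ex) (use assms in blast)
  then show thesis using that by blast
qed

lemma (in pair_graph) connected_apath:
  assumes "Digraph_Component.connected (with_proj G)" "u \<in> pverts G" "v \<in> pverts G"
  obtains p where "apath u p v"
proof -
  have "strongly_connected (with_proj G)"
    using symmetric_connected_imp_strongly_connected assms(1) sym_arcs by blast
  then have "u \<rightarrow>\<^sup>*\<^bsub>with_proj G\<^esub> v"
    using assms(2,3) by (auto simp: strongly_connected_def)
  then show thesis using that reachable_apath by blast
qed

section \<open>Systems of edge cuts\<close>

text \<open>
  \<open>S e\<close> is the side of \<open>fst e\<close> after deleting the edge \<open>e\<close>.  Such a system of cuts exists precisely in
  trees, but is easier to exhibit for concrete graphs than the absence of cycles.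
\<close>

locale edge_cuts = pair_graph +
  fixes S :: "'a \<times> 'a \<Rightarrow> 'a set"
  assumes conn: "Digraph_Component.connected (with_proj G)"
    and side_subset: "e \<in> parcs G \<Longrightarrow> S e \<subseteq> pverts G"
    and fst_side: "e \<in> parcs G \<Longrightarrow> fst e \<in> S e"
    and snd_side: "e \<in> parcs G \<Longrightarrow> snd e \<notin> S e"
    and crossing: "\<lbrakk>e \<in> parcs G; (a, b) \<in> parcs G; a \<in> S e; b \<notin> S e\<rbrakk> \<Longrightarrow> (a, b) = e"
begin

text \<open>Read backwards from \<open>fst e\<close>, which lies in \<open>S e\<close>: the first
  step out of \<open>S e\<close> would be along \<open>e\<close> itself, so the walk would visit
  \<open>snd e\<close>.\<close>

lemma awalk_before_cut:
  assumes "awalk u p (fst e)" "snd e \<notin> set (awalk_verts u p)" "e \<in> parcs G"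
  shows "set (awalk_verts u p) \<subseteq> S e"
  using assms(1,2)
proof (induct p arbitrary: u)
  case Nil
  then show ?case using fst_side[OF assms(3)] by (auto simp: awalk_simps)
next
  case (Cons f p)
  have f: "f \<in> parcs G" "u = fst f" "awalk (snd f) p (fst e)"
    using Cons.prems(1) by (auto simp: awalk_simps)
  have sub: "set (awalk_verts (snd f) p) \<subseteq> S e"
    using Cons f by auto
  have "snd f \<in> S e" using sub hd_in_awalk_verts(1)[OF f(3)] by auto
  moreover have "(snd f, fst f) \<noteq> e" using Cons.prems(2) by auto
  ultimately have "fst f \<in> S e"
    using crossing[OF assms(3), of "snd f" "fst f"] arcs_symmetric[of "fst f" "snd f"] f by auto
  then show ?case using sub by auto
qed

text \<open>Mirror image of \<open>awalk_before_cut\<close>: entering \<open>S e\<close> from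
  outside means traversing \<open>e\<close> backwards, which ends in \<open>fst e\<close>.\<close>

lemma awalk_after_cut:
  assumes "awalk u p v" "u \<notin> S e" "fst e \<notin> set (awalk_verts u p)" "e \<in> parcs G"
  shows "set (awalk_verts u p) \<inter> S e = {}"
  using assms(1-3)
proof (induct p arbitrary: u)
  case Nil
  then show ?case by auto
next
  case (Cons f p)
  have f: "f \<in> parcs G" "u = fst f" "awalk (snd f) p v"
    using Cons.prems(1) by (auto simp: awalk_simps)
  have "snd f \<noteq> fst e"
    using Cons.prems(3) hd_in_awalk_verts(1)[OF f(3)] by auto
  then have "snd f \<notin> S e"
    using crossing[OF assms(4), of "snd f" "fst f"] arcs_symmetric[of "fst f" "snd f"]
      f Cons.prems(2) by auto
  with Cons f show ?case by auto
qed

text \<open>A path visits neither end of \<open>e\<close> twice, so its part before \<open>e\<close>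
  avoids \<open>snd e\<close> and its part after \<open>e\<close> avoids
  \<open>fst e\<close>.\<close>

lemma apath_cut:
  assumes "apath u (p @ e # q) v"
  shows "set (awalk_verts u p) \<subseteq> S e" "set (awalk_verts (snd e) q) \<inter> S e = {}"
proof -
  have w: "awalk u p (fst e)" "e \<in> parcs G" "awalk (snd e) q v"
    using assms by (auto simp: apath_def awalk_simps)
  have "awalk u (p @ e # q) v" using assms unfolding apath_def by blast
  from awalk_verts_append[OF this]
  have "awalk_verts u (p @ e # q) = awalk_verts u p @ awalk_verts (snd e) q" by simp
  then have d: "set (awalk_verts u p) \<inter> set (awalk_verts (snd e) q) = {}"
    using assms by (auto simp: apath_def)
  moreover have "fst e \<in> set (awalk_verts u p)" "snd e \<in> set (awalk_verts (snd e) q)"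
    using w hd_in_awalk_verts(1)[OF w(3)] last_in_set[of "awalk_verts u p"] by auto
  ultimately show "set (awalk_verts u p) \<subseteq> S e" "set (awalk_verts (snd e) q) \<inter> S e = {}"
    using awalk_before_cut[OF w(1)] awalk_after_cut[OF w(3)] w(2) snd_side by blast+
qed

lemma apath_cut_ends:
  assumes "apath u p v" "e \<in> set p"
  shows "e \<in> parcs G" "u \<in> S e" "v \<notin> S e"
proof -
  obtain q r where p: "p = q @ e # r" using assms(2) split_list by metis
  have w: "awalk u q (fst e)" "e \<in> parcs G" "awalk (snd e) r v"
    using assms(1) p by (auto simp: apath_def awalk_simps)
  show "e \<in> parcs G" by fact
  show "u \<in> S e" using apath_cut(1) assms(1) p hd_in_awalk_verts(1)[OF w(1)] by blast
  have "v \<in> set (awalk_verts (snd e) r)" 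
    using w(3) last_in_set[of "awalk_verts (snd e) r"] by auto
  then show "v \<notin> S e" using apath_cut(2) assms(1) p by blast
qed

text \<open>A cycle minus its first arc \<open>e\<close> is a path back to \<open>fst e\<close>. If
  nonempty, its first arc separates its ends; the reverse of \<open>e\<close> joins them, so it is
  that arc and the path ends there.\<close>

lemma cycle_length_le_2:
  assumes "cycle p"
  shows "length p \<le> 2"
proof (cases p)
  case (Cons e q)
  obtain u where u: "awalk u p u" "distinct (tl (awalk_verts u p))"
    using assms unfolding cycle_def by auto
  have e: "e \<in> parcs G" "u = fst e" and q: "apath (snd e) q u"
    using u Cons by (auto simp: apath_def awalk_simps)
  show ?thesis
  proof (cases q)
    case q': (Cons f r)
    have f: "f \<in> parcs G" "fst f = snd e" and r: "apath (snd f) r u"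
      using q q' by (auto simp: apath_Cons_iff)
    have "snd e \<in> S f" "u \<notin> S f"
      using apath_cut_ends[OF q, of f] q' by auto
    then have "(snd e, u) = f"
      using crossing[OF f(1)] arcs_symmetric[of "fst e" "snd e"] e by auto
    then have "apath u r u" using r by auto
    then have "r = []" using apath_nonempty_ends by blast
    then show ?thesis using Cons q' by simp
  qed (use Cons in simp)
qed simp

lemma tree_graph: "tree_graph G"
  unfolding tree_graph_def using conn cycle_length_le_2 by fastforce

section \<open>Edge weights and separated pairs\<close>

lemma rev_arc: "e \<in> parcs G \<Longrightarrow> (snd e, fst e) \<in> parcs G"
  using arcs_symmetric[of "fst e" "snd e"] by simp

text \<open>For an arc \<open>e\<close>, this counts the ordered pairs with first component in
  \<open>S e\<close> and second one outside.\<close>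

abbreviation weight :: "'a \<times> 'a \<Rightarrow> real" where
  "weight e \<equiv> real (card (S e)) * (real (card (pverts G)) - real (card (S e)))"

lemma weight_eq: "e \<in> parcs G \<Longrightarrow> weight e = real (card (S e) * card (pverts G - S e))"
  using card_mono[OF pair_finite_verts side_subset[of e]]
  by (simp add: card_Diff_subset[OF finite_subset[OF side_subset pair_finite_verts] side_subset] of_nat_diff)

lemma weight_pos: "e \<in> parcs G \<Longrightarrow> weight e > 0"
proof -
  assume e: "e \<in> parcs G"
  then have "fst e \<in> S e" "snd e \<in> pverts G - S e" "finite (S e)"
    using fst_side[OF e] snd_side[OF e] arc_snd_in_verts[OF e]
      finite_subset[OF side_subset[OF e] pair_finite_verts] by auto
  then have "card (S e) > 0" "card (pverts G - S e) > 0"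
    using pair_finite_verts unfolding card_gt_0_iff by auto
  then show ?thesis using weight_eq[OF e] by simp
qed

text \<open>Triangle inequality along a path from \<open>u\<close> to \<open>v\<close>, all of whose
  arcs separate \<open>u\<close> from \<open>v\<close> by \<open>apath_cut_ends\<close>.\<close>

lemma abs_diff_le_sum_cuts:
  fixes x :: "'a \<Rightarrow> real"
  assumes "u \<in> pverts G" "v \<in> pverts G"
  shows "\<bar>x u - x v\<bar> \<le> (\<Sum>e\<in>{e \<in> parcs G. u \<in> S e \<and> v \<notin> S e}. \<bar>x (fst e) - x (snd e)\<bar>)"
proof -
  obtain p where p: "apath u p v" using connected_apath[OF conn assms] .
  have "\<bar>x u - x v\<bar> \<le> (\<Sum>e\<in>set p. \<bar>x (fst e) - x (snd e)\<bar>)"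
    using p
  proof (induct p arbitrary: u)
    case (Cons f p)
    \<comment> \<open>The sum over \<open>set p\<close> loses no term: a repeated arc would make the
      path revisit its start.\<close>
    then have "f \<notin> set p" by (auto simp: apath_Cons_iff dest: awalk_verts_arc1)
    with Cons show ?case by (force simp: apath_Cons_iff)
  qed (auto simp: apath_Nil_iff)
  also have "\<dots> \<le> (\<Sum>e\<in>{e \<in> parcs G. u \<in> S e \<and> v \<notin> S e}. \<bar>x (fst e) - x (snd e)\<bar>)"
    using apath_cut_ends[OF p] by (intro sum_mono2) (auto simp: pair_finite_arcs)
  finally show ?thesis .
qed

text \<open>Double counting: after exchanging the sums, each arc is charged once for every ordered
  pair it separates.\<close>

lemma sum_pairs_le:
  fixes x :: "'a \<Rightarrow> real"
  shows "(\<Sum>u\<in>pverts G. \<Sum>v\<in>pverts G. \<bar>x u - x v\<bar>)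
    \<le> (\<Sum>e\<in>parcs G. weight e * \<bar>x (fst e) - x (snd e)\<bar>)"
proof -
  let ?d = "\<lambda>e. \<bar>x (fst e) - x (snd e)\<bar>" and ?V = "pverts G"
  have "(\<Sum>u\<in>?V. \<Sum>v\<in>?V. \<bar>x u - x v\<bar>)
      \<le> (\<Sum>u\<in>?V. \<Sum>v\<in>?V. \<Sum>e\<in>{e \<in> parcs G. u \<in> S e \<and> v \<notin> S e}. ?d e)"
    by (intro sum_mono abs_diff_le_sum_cuts)
  also have "\<dots> = (\<Sum>u\<in>?V. \<Sum>v\<in>?V. \<Sum>e\<in>parcs G. if u \<in> S e \<and> v \<notin> S e then ?d e else 0)"
    by (simp add: sum.inter_filter pair_finite_arcs)
  also have "\<dots> = (\<Sum>u\<in>?V. \<Sum>e\<in>parcs G. \<Sum>v\<in>?V. if u \<in> S e \<and> v \<notin> S e then ?d e else 0)"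
    by (intro sum.cong refl sum.swap)
  also have "\<dots> = (\<Sum>e\<in>parcs G. \<Sum>u\<in>?V. \<Sum>v\<in>?V. if u \<in> S e \<and> v \<notin> S e then ?d e else 0)"
    by (rule sum.swap)
  also have "\<dots> = (\<Sum>e\<in>parcs G. weight e * ?d e)"
  proof (intro sum.cong refl)
    fix e assume e: "e \<in> parcs G"
    have "(\<Sum>u\<in>?V. \<Sum>v\<in>?V. if u \<in> S e \<and> v \<notin> S e then ?d e else 0)
        = (\<Sum>u\<in>?V. if u \<in> S e then \<Sum>v\<in>?V. if v \<notin> S e then ?d e else 0 else 0)"
      by (intro sum.cong refl) auto
    also have "\<dots> = (\<Sum>u\<in>{u \<in> ?V. u \<in> S e}. \<Sum>v\<in>{v \<in> ?V. v \<notin> S e}. ?d e)"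
      by (simp only: sum.inter_filter[OF pair_finite_verts])
    also have "{u \<in> ?V. u \<in> S e} = S e" using side_subset[OF e] by auto
    also have "{v \<in> ?V. v \<notin> S e} = ?V - S e" by auto
    finally show "(\<Sum>u\<in>?V. \<Sum>v\<in>?V. if u \<in> S e \<and> v \<notin> S e then ?d e else 0) = weight e * ?d e"
      by (simp add: weight_eq[OF e])
  qed
  finally show ?thesis .
qed

lemma edge_variation_alt: "edge_variation G x = (\<Sum>e\<in>parcs G. \<bar>x (fst e) - x (snd e)\<bar>) / 2"
  by (simp add: edge_variation_def case_prod_unfold)

text \<open>Only \<open>e\<close> and its reverse join the two sides, and these two equal terms
  cancel the factor \<open>1/2\<close>.\<close>

lemma edge_variation_cut:
  assumes e: "e \<in> parcs G"
  shows "edge_variation G (\<lambda>v. if v \<in> S e then s else t) = \<bar>s - t\<bar>"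
proof -
  let ?x = "\<lambda>v. if v \<in> S e then s else t" and ?e' = "(snd e, fst e)"
  have "fst e \<noteq> snd e" using pair_no_loops[OF e] .
  then have ne: "e \<noteq> ?e'" by (cases e) auto
  have "(\<Sum>f\<in>parcs G. \<bar>?x (fst f) - ?x (snd f)\<bar>) = (\<Sum>f\<in>{e, ?e'}. \<bar>?x (fst f) - ?x (snd f)\<bar>)"
  proof (rule sum.mono_neutral_right)
    show "\<forall>f\<in>parcs G - {e, ?e'}. \<bar>?x (fst f) - ?x (snd f)\<bar> = 0"
    proof
      fix f assume f: "f \<in> parcs G - {e, ?e'}"
      have "fst f \<in> S e \<longleftrightarrow> snd f \<in> S e"
        using crossing[OF e, of "fst f" "snd f"] crossing[OF e, of "snd f" "fst f"] f rev_arc[of f]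
        by (metis DiffE fst_conv insertCI prod.collapse snd_conv)
      then show "\<bar>?x (fst f) - ?x (snd f)\<bar> = 0" by auto
    qed
  qed (use e rev_arc pair_finite_arcs in auto)
  also have "\<dots> = 2 * \<bar>s - t\<bar>"
    using ne fst_side[OF e] snd_side[OF e] by auto
  finally show ?thesis by (simp add: edge_variation_alt)
qed

end

section \<open>The Fiedler value in terms of cuts\<close>

text \<open>Since \<open>x\<close> sums to \<open>0\<close>, the differences
  \<open>x u - x v\<close> sum over \<open>v\<close> to \<open>card V * x u\<close>.\<close>

lemma sum_abs_le_sum_pairs:
  fixes x :: "'b \<Rightarrow> real"
  assumes "(\<Sum>v\<in>V. x v) = 0"
  shows "real (card V) * (\<Sum>v\<in>V. \<bar>x v\<bar>) \<le> (\<Sum>u\<in>V. \<Sum>v\<in>V. \<bar>x u - x v\<bar>)"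
proof -
  have "real (card V) * \<bar>x u\<bar> \<le> (\<Sum>v\<in>V. \<bar>x u - x v\<bar>)" for u
  proof -
    have "real (card V) * \<bar>x u\<bar> = \<bar>\<Sum>v\<in>V. x u - x v\<bar>"
      using assms by (simp add: sum_subtractf abs_mult)
    also have "\<dots> \<le> (\<Sum>v\<in>V. \<bar>x u - x v\<bar>)" by (rule sum_abs)
    finally show ?thesis .
  qed
  then show ?thesis by (simp add: sum_distrib_left sum_mono)
qed

context edge_cuts begin

lemma l1_fiedler_eq:
  assumes e: "e \<in> parcs G" and max: "\<And>f. f \<in> parcs G \<Longrightarrow> weight f \<le> weight e"
  shows "l1_fiedler G = real (card (pverts G)) / (2 * weight e)"
proof -
  let ?V = "pverts G"
  define n a b where "n = real (card ?V)" and "a = real (card (S e))" and "b = real (card (?V - S e))"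
  note fin = finite_subset[OF side_subset[OF e] pair_finite_verts]
  have w: "weight e = a * b" using weight_eq[OF e] by (simp add: a_def b_def)
  have ab: "a > 0" "b > 0"
    using weight_pos[OF e] unfolding w a_def b_def by (auto simp: zero_less_mult_iff)
  have n: "n = a + b"
    using card_mono[OF pair_finite_verts side_subset[OF e]]
    by (simp add: n_def a_def b_def card_Diff_subset[OF fin side_subset[OF e]] of_nat_diff)
  \<comment> \<open>Each side receives total absolute value \<open>1/2\<close>, with opposite signs.
    The jump across \<open>e\<close> is then \<open>1/(2a) + 1/(2b) = n/(2ab)\<close>.\<close>
  define y where "y v = (if v \<in> S e then 1 / (2 * a) else - 1 / (2 * b))" for v
  have split: "(\<Sum>v\<in>?V. f (y v)) = a * f (1 / (2 * a)) + b * f (- 1 / (2 * b))" for f :: "real \<Rightarrow> real"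
    using sum.subset_diff[OF side_subset[OF e] pair_finite_verts, of "\<lambda>v. f (y v)"]
    by (simp add: y_def a_def b_def)
  show ?thesis unfolding l1_fiedler_def
  proof (rule Least_equality)
    have "(\<Sum>v\<in>?V. y v) = 0" "(\<Sum>v\<in>?V. \<bar>y v\<bar>) = 1"
      using split[of "\<lambda>t. t"] split[of abs] ab by auto
    moreover have "edge_variation G y = n / (2 * weight e)"
      unfolding y_def edge_variation_cut[OF e] w n using ab by (simp add: field_simps)
    ultimately show "\<exists>x. (\<Sum>v\<in>?V. x v) = 0 \<and> (\<Sum>v\<in>?V. \<bar>x v\<bar>) = 1
        \<and> real (card ?V) / (2 * weight e) = edge_variation G x"
      unfolding n_def by metis
  next
    fix m assume "\<exists>x. (\<Sum>v\<in>?V. x v) = 0 \<and> (\<Sum>v\<in>?V. \<bar>x v\<bar>) = 1 \<and> m = edge_variation G x"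
    then obtain x where x: "(\<Sum>v\<in>?V. x v) = 0" "(\<Sum>v\<in>?V. \<bar>x v\<bar>) = 1" "m = edge_variation G x"
      by blast
    have "real (card ?V) \<le> (\<Sum>u\<in>?V. \<Sum>v\<in>?V. \<bar>x u - x v\<bar>)"
      using sum_abs_le_sum_pairs[OF x(1)] x(2) by simp
    also have "\<dots> \<le> (\<Sum>f\<in>parcs G. weight f * \<bar>x (fst f) - x (snd f)\<bar>)"
      by (rule sum_pairs_le)
    also have "\<dots> \<le> (\<Sum>f\<in>parcs G. weight e * \<bar>x (fst f) - x (snd f)\<bar>)"
      by (intro sum_mono mult_right_mono max) auto
    also have "\<dots> = 2 * weight e * m"
      by (simp add: x(3) edge_variation_alt flip: sum_distrib_left)
    finally show "real (card ?V) / (2 * weight e) \<le> m"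
      using weight_pos[OF e] by (simp add: field_simps)
  qed
qed

text \<open>Cut at the \<open>k\<close>-th arc of the path: the \<open>k\<close> path vertices
  before the cut stay on one side, the remaining ones on the other.\<close>

lemma apath_balanced_arc:
  assumes "apath u p v" "0 < k" "k \<le> length p"
  obtains e where "e \<in> parcs G" "k \<le> card (S e)" "length p + 1 - k \<le> card (pverts G - S e)"
proof -
  define q e r where "q = take (k - 1) p" and "e = p ! (k - 1)" and "r = drop k p"
  have p: "p = q @ e # r" and len: "length q = k - 1" "length r = length p - k"
    using id_take_nth_drop[of "k - 1" p] assms(2,3) by (auto simp: q_def e_def r_def)
  have path: "apath u (q @ e # r) v" using assms(1) p by simp
  then have e: "e \<in> parcs G" and w: "awalk (snd e) r v"
    by (auto simp: apath_def awalk_simps)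
  have "awalk u (q @ e # r) v" "distinct (awalk_verts u (q @ e # r))"
    using path unfolding apath_def by blast+
  with awalk_verts_append[OF this(1)]
  have d: "distinct (awalk_verts u q)" "distinct (awalk_verts (snd e) r)" by auto
  have "k = card (set (awalk_verts u q))"
    using distinct_card[OF d(1)] length_awalk_verts[of u q] len(1) assms(2) by simp
  also have "\<dots> \<le> card (S e)"
    using apath_cut(1)[OF path] finite_subset[OF side_subset[OF e] pair_finite_verts]
    by (intro card_mono)
  finally have "k \<le> card (S e)" .
  moreover have "length p + 1 - k = card (set (awalk_verts (snd e) r))"
    using distinct_card[OF d(2)] length_awalk_verts[of "snd e" r] len(2) assms(3) by simp
  moreover have "\<dots> \<le> card (pverts G - S e)"
    using apath_cut(2)[OF path] w pair_finite_verts by (intro card_mono) auto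
  ultimately show thesis using that[OF e] by simp
qed

end

section \<open>The cuts of a tree\<close>

lemma (in pair_wf_digraph) rtrancl_imp_awalk:
  assumes "(a, b) \<in> R\<^sup>*" "R \<subseteq> parcs G" "a \<in> pverts G"
  shows "\<exists>p. awalk a p b \<and> set p \<subseteq> R"
  using assms(1)
proof induct
  case base
  show ?case using assms(3) by (intro exI[of _ "[]"]) (auto simp: awalk_simps)
next
  case (step y z)
  then obtain p where p: "awalk a p y" "set p \<subseteq> R" by blast
  have "awalk y [(y, z)] z"
    using step(2) assms(2) by (auto simp: awalk_simps dest: in_arcsD2)
  from awalk_appendI[OF p(1) this] show ?case
    using p(2) step(2) by (intro exI[of _ "p @ [(y, z)]"]) auto
qed

text \<open>The side of \<open>e\<close> is what \<open>fst e\<close> reaches once \<open>e\<close>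
  and its reverse are removed. If it contained \<open>snd e\<close>, a path to \<open>snd e\<close>
  together with the reverse of \<open>e\<close> would be a cycle of length at least 3.\<close>

lemma tree_graph_edge_cuts:
  assumes "tree_graph G"
  shows "edge_cuts G (\<lambda>e. {w. (fst e, w) \<in> (parcs G - {e, (snd e, fst e)})\<^sup>*})"
proof -
  interpret pair_graph G using assms by (simp add: tree_graph_def)
  let ?R = "\<lambda>e. parcs G - {e, (snd e, fst e)}"
  show ?thesis
  proof unfold_locales
    show "Digraph_Component.connected (with_proj G)" using assms by (simp add: tree_graph_def)
  next
    fix e assume e: "e \<in> parcs G"
    show "{w. (fst e, w) \<in> (?R e)\<^sup>*} \<subseteq> pverts G"
      using rtrancl_imp_awalk[of "fst e" _ "?R e"] arc_fst_in_verts[OF e] by (auto dest: awalk_last_in_verts)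
    show "fst e \<in> {w. (fst e, w) \<in> (?R e)\<^sup>*}" by simp
    show "snd e \<notin> {w. (fst e, w) \<in> (?R e)\<^sup>*}"
    proof
      assume "snd e \<in> {w. (fst e, w) \<in> (?R e)\<^sup>*}"
      then obtain p where "awalk (fst e) p (snd e)" "set p \<subseteq> ?R e"
        using rtrancl_imp_awalk[of "fst e" "snd e" "?R e"] arc_fst_in_verts[OF e] by auto
      then obtain q where q: "apath (fst e) q (snd e)" "set q \<subseteq> ?R e"
        using awalk_shorten by fast
      have "(snd e, fst e) \<in> parcs G" using arcs_symmetric[of "fst e" "snd e"] e by simp
      then have "cycle ((snd e, fst e) # q)"
        using q(1) unfolding cycle_def by (intro exI[of _ "snd e"]) (auto simp: apath_def awalk_simps)
      \<comment> \<open>An empty path would make \<open>e\<close> a loop; a path with one arc would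
        be \<open>e\<close> itself, which has been removed.\<close>
      moreover have "length q \<ge> 2"
      proof (rule ccontr)
        assume "\<not> length q \<ge> 2"
        then consider "q = []" | f where "q = [f]"
          by (cases q) (auto simp: Suc_le_eq)
        then show False
        proof cases
          case 1
          then show ?thesis using q(1) pair_no_loops[OF e] by (auto simp: apath_simps)
        next
          case 2
          then have "f = e" using q(1) by (auto simp: apath_simps prod_eq_iff)
          then show ?thesis using q(2) 2 by auto
        qed
      qed
      ultimately show False using assms unfolding tree_graph_def by force
    qed
  next
    fix e a b
    assume "e \<in> parcs G" and ab: "(a, b) \<in> parcs G" "a \<in> {w. (fst e, w) \<in> (?R e)\<^sup>*}"
      "b \<notin> {w. (fst e, w) \<in> (?R e)\<^sup>*}"
    then have "(a, b) \<notin> ?R e" by (auto intro: rtrancl_into_rtrancl)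
    \<comment> \<open>Of the two removed arcs, the reverse of \<open>e\<close> is ruled out because
      it ends in \<open>fst e\<close>, which lies on the side of \<open>e\<close>.\<close>
    moreover have "b \<noteq> fst e" using ab(3) by auto
    ultimately show "(a, b) = e" using ab(1) by auto
  qed
qed

section \<open>Bounds for trees of given diameter\<close>

lemma (in pair_fin_digraph) finite_graph_dists:
  "finite {graph_dist G u v |u v. u \<in> pverts G \<and> v \<in> pverts G}"
proof -
  have "{graph_dist G u v |u v. u \<in> pverts G \<and> v \<in> pverts G}
      = (\<lambda>(u, v). graph_dist G u v) ` (pverts G \<times> pverts G)" by auto
  then show ?thesis using pair_finite_verts by simp
qed

lemma (in edge_cuts) diametral_apath:
  obtains u p v where "apath u p v" "length p = graph_diameter G"
proof -
  have "pverts G \<noteq> {}"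
    using conn by (auto simp: connected_def strongly_connected_def)
  then have "graph_diameter G \<in> {graph_dist G u v |u v. u \<in> pverts G \<and> v \<in> pverts G}"
    unfolding graph_diameter_def by (intro Max_in finite_graph_dists) auto
  then obtain u v where uv: "u \<in> pverts G" "v \<in> pverts G" "graph_diameter G = graph_dist G u v"
    by auto
  obtain p where "apath u p v" using connected_apath[OF conn uv(1,2)] .
  then show thesis using graph_dist_apath that uv(3) by metis
qed

text \<open>The difference of the two products is \<open>(a - k) * (n - a - k)\<close>; as a
  function of \<open>a\<close>, the right-hand side is concave and symmetric about
  \<open>n / 2\<close>.\<close>

lemma mult_diff_mono:
  fixes a k n :: real
  assumes "k \<le> a" "a \<le> n - k"
  shows "k * (n - k) \<le> a * (n - a)"
proof -
  have "0 \<le> (a - k) * (n - a - k)" using assms by simp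
  then show ?thesis by (simp add: algebra_simps)
qed

lemma mult_diff_le_half:
  assumes "a \<le> n"
  shows "real a * (real n - real a) \<le> real (n div 2) * (real n - real (n div 2))"
proof (cases "a \<le> n div 2")
  case True
  then show ?thesis by (intro mult_diff_mono) linarith+
next
  case False
  \<comment> \<open>Beyond the half, \<open>a\<close> is replaced by \<open>n - a\<close>, which
    leaves the product unchanged.\<close>
  have "(real n - real a) * (real n - (real n - real a)) \<le> real (n div 2) * (real n - real (n div 2))"
    using False assms by (intro mult_diff_mono) linarith+
  then show ?thesis by (simp add: mult.commute)
qed

lemma ceiling_half: "\<lceil>real n / 2\<rceil> = int ((n + 1) div 2)"
  by linarith

lemma floor_half: "\<lfloor>real n / 2\<rfloor> = int (n div 2)"
  by linarith

text \<open>Brings the denominator of the lower bound into the form of a weight.\<close>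

lemma half_mult_half:
  "2 * of_int \<lceil>real n / 2\<rceil> * of_int \<lfloor>real n / 2\<rfloor> = 2 * (real (n div 2) * (real n - real (n div 2)))"
proof -
  have "(n + 1) div 2 + n div 2 = n" by presburger
  then have "real ((n + 1) div 2) = real n - real (n div 2)" by linarith
  then show ?thesis by (simp add: ceiling_half floor_half)
qed

text \<open>The value is inversely proportional to the weight of a heaviest edge, so bounding that
  weight from above and below gives the two bounds.\<close>

lemma l1_fiedler_tree_bounds:
  assumes "tree_graph G" "card (pverts G) = n" "graph_diameter G = D" "D \<ge> 1"
  shows "real n / (2 * of_int \<lceil>real n / 2\<rceil> * of_int \<lfloor>real n / 2\<rfloor>) \<le> l1_fiedler G"
    and "l1_fiedler G \<le> real n / (2 * of_int \<lceil>real D / 2\<rceil> * (real n - of_int \<lceil>real D / 2\<rceil>))"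
proof -
  define S where "S e = {w. (fst e, w) \<in> (parcs G - {e, (snd e, fst e)})\<^sup>*}" for e
  interpret edge_cuts G S
    using tree_graph_edge_cuts[OF assms(1)] unfolding S_def .
  define k where "k = (D + 1) div 2"
  obtain u p v where p: "apath u p v" "length p = D" using diametral_apath assms(3) by metis
  \<comment> \<open>A middle arc of a diametral path. As \<open>k\<close> is the ceiling of
    \<open>D / 2\<close>, also \<open>D + 1 - k\<close> is at least \<open>k\<close>, so both sides
    have at least \<open>k\<close> vertices.\<close>
  obtain e where e: "e \<in> parcs G" "k \<le> card (S e)" "D + 1 - k \<le> card (pverts G - S e)"
  proof (rule apath_balanced_arc[OF p(1), of k])
    show "0 < k" "k \<le> length p" using p(2) assms(4) by (auto simp: k_def)
  qed (use p(2) in auto)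
  have "Max (weight ` parcs G) \<in> weight ` parcs G"
    using e(1) pair_finite_arcs by (intro Max_in) auto
  then obtain m where m: "m \<in> parcs G" "weight m = Max (weight ` parcs G)" by auto
  then have max: "weight f \<le> weight m" if "f \<in> parcs G" for f
    using that pair_finite_arcs by simp
  have b: "l1_fiedler G = real n / (2 * weight m)"
    using l1_fiedler_eq[OF m(1) max] assms(2) by simp
  have card_le: "card (S f) \<le> n" if "f \<in> parcs G" for f
    using card_mono[OF pair_finite_verts side_subset[OF that]] assms(2) by simp
  have "weight m \<le> real (n div 2) * (real n - real (n div 2))"
    using mult_diff_le_half[OF card_le[OF m(1)]] assms(2) by simp
  then show "real n / (2 * of_int \<lceil>real n / 2\<rceil> * of_int \<lfloor>real n / 2\<rfloor>) \<le> l1_fiedler G"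
    unfolding b half_mult_half using weight_pos[OF m(1)] by (intro frac_le; linarith)
  have "card (pverts G - S e) = n - card (S e)"
    using card_Diff_subset[OF finite_subset[OF side_subset[OF e(1)] pair_finite_verts] side_subset[OF e(1)]]
      assms(2) by simp
  then have k: "k \<le> card (S e)" "card (S e) + k \<le> n" "1 \<le> k"
    using e(2,3) card_le[OF e(1)] assms(4) unfolding k_def by linarith+
  then have "real k * (real n - real k) \<le> weight e"
    unfolding assms(2) by (intro mult_diff_mono) auto
  also have "\<dots> \<le> weight m" using max[OF e(1)] .
  finally have "real k * (real n - real k) \<le> weight m" .
  moreover have "0 < real k * (real n - real k)" using k by auto
  ultimately show "l1_fiedler G \<le> real n / (2 * of_int \<lceil>real D / 2\<rceil> * (real n - of_int \<lceil>real D / 2\<rceil>))"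
    unfolding b ceiling_half k_def[symmetric] of_int_of_nat_eq mult.assoc
    by (intro frac_le; linarith)
qed

section \<open>Caterpillars and their diameter\<close>

lemma length_rev_path: "length (rev_path p) = length p"
  by (induct p) auto

text \<open>
  The vertices \<open>0, \<dots>, D\<close> form a path, and each \<open>v > D\<close> is a leaf attached to \<open>c v\<close>.
\<close>

locale caterpillar =
  fixes n D :: nat and c :: "nat \<Rightarrow> nat"
  assumes D_less: "D < n" and foot: "\<And>v. 0 < c v" "\<And>v. c v < D"
begin

text \<open>The tree is rooted at \<open>0\<close>: every edge joins some \<open>v > 0\<close> to
  its parent, which carries a smaller number.\<close>

definition parent :: "nat \<Rightarrow> nat" where
  "parent v = (if v \<le> D then v - 1 else c v)"

text \<open>The projection to the path, through which distances are estimated.\<close>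

definition pos :: "nat \<Rightarrow> nat" where
  "pos v = (if v \<le> D then v else c v)"

definition graph :: "nat pair_pre_digraph" where
  "graph = \<lparr>pverts = {..<n},
     parcs = {(v, parent v) |v. 0 < v \<and> v < n} \<union> {(parent v, v) |v. 0 < v \<and> v < n}\<rparr>"

text \<open>The descendants of \<open>v\<close>, including \<open>v\<close>: the part that contains
  \<open>v\<close> when the edge to its parent is deleted.\<close>

definition branch :: "nat \<Rightarrow> nat set" where
  "branch v = (if v \<le> D then {w \<in> {..<n}. v \<le> pos w} else {v})"

text \<open>As parents have smaller numbers, the comparison tells whether \<open>e\<close> points
  towards the root.\<close>

definition side :: "nat \<times> nat \<Rightarrow> nat set" where
  "side e = (if snd e < fst e then branch (fst e) else {..<n} - branch (snd e))"

lemma parent_less: "0 < v \<Longrightarrow> parent v < v"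
  using foot[of v] by (auto simp: parent_def)

lemma pverts_graph [simp]: "pverts graph = {..<n}"
  by (simp add: graph_def)

lemma arc_cases:
  assumes "e \<in> parcs graph"
  obtains (up) v where "0 < v" "v < n" "e = (v, parent v)"
    | (down) v where "0 < v" "v < n" "e = (parent v, v)"
  using assms by (auto simp: graph_def)

lemma arcs_graph: "0 < v \<Longrightarrow> v < n \<Longrightarrow> (v, parent v) \<in> parcs graph"
  "0 < v \<Longrightarrow> v < n \<Longrightarrow> (parent v, v) \<in> parcs graph"
  by (auto simp: graph_def)

sublocale pair_graph graph
proof unfold_locales
  have "parcs graph = (\<lambda>v. (v, parent v)) ` {0<..<n} \<union> (\<lambda>v. (parent v, v)) ` {0<..<n}"
    by (auto simp: graph_def)
  then show "finite (parcs graph)" by simp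
  show "symmetric (with_proj graph)"
    unfolding symmetric_def with_proj_simps by (rule symI) (auto simp: graph_def)
  show "fst e \<in> pverts graph" "snd e \<in> pverts graph" "fst e \<noteq> snd e" if "e \<in> parcs graph" for e
    using that by (cases rule: arc_cases; force dest: parent_less)+
qed simp

lemma spine_awalk:
  assumes "i \<le> D" "j \<le> D"
  shows "\<exists>p. awalk i p j \<and> real (length p) = \<bar>real i - real j\<bar>"
proof -
  have down: "\<exists>p. awalk j p i \<and> length p = j - i" if "i \<le> j" "j \<le> D" for i j
    using that
  proof (induct j)
    case 0
    then show ?case using D_less by (intro exI[of _ "[]"]) (auto simp: awalk_simps)
  next
    case (Suc j)
    show ?case
    proof (cases "i = Suc j")
      case True
      then show ?thesis using Suc.prems D_less by (intro exI[of _ "[]"]) (auto simp: awalk_simps)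
    next
      case False
      then obtain p where p: "awalk j p i" "length p = j - i" using Suc by auto
      have "(Suc j, j) \<in> parcs graph"
        using arcs_graph(1)[of "Suc j"] Suc.prems D_less by (simp add: parent_def)
      then show ?thesis
        using p False Suc.prems by (intro exI[of _ "(Suc j, j) # p"]) (auto simp: awalk_simps)
    qed
  qed
  show ?thesis
  proof (cases "i \<le> j")
    case True
    then obtain p where "awalk j p i" "length p = j - i" using down assms by blast
    then show ?thesis using True by (intro exI[of _ "rev_path p"]) (simp add: length_rev_path)
  next
    case False
    then obtain p where "awalk i p j" "length p = i - j" using down[of j i] assms by auto
    then show ?thesis using False by (intro exI[of _ p]) auto
  qed
qed

lemma leg_awalk:
  assumes "v < n"
  shows "\<exists>p. awalk v p (pos v) \<and> length p = (if v \<le> D then 0 else 1)"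
proof (cases "v \<le> D")
  case True
  then show ?thesis using assms by (intro exI[of _ "[]"]) (auto simp: awalk_simps pos_def)
next
  case False
  then show ?thesis
    using assms arcs_graph(1)[of v] foot[of v] D_less
    by (intro exI[of _ "[(v, c v)]"]) (auto simp: awalk_simps pos_def parent_def)
qed

lemma pos_le: "pos v \<le> D"
  using foot[of v] by (auto simp: pos_def)

text \<open>A pendant vertex costs one extra step, but its foot is an inner vertex of the path,
  within \<open>D - 1\<close> of every path vertex and within \<open>D - 2\<close> of any other
  foot.\<close>

lemma awalk_le_D:
  assumes "u < n" "v < n"
  shows "\<exists>p. awalk u p v \<and> length p \<le> D"
proof -
  obtain p where p: "awalk u p (pos u)" "length p = (if u \<le> D then 0 else 1)"
    using leg_awalk[OF assms(1)] by blast
  obtain q where q: "awalk v q (pos v)" "length q = (if v \<le> D then 0 else 1)"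
    using leg_awalk[OF assms(2)] by blast
  obtain r where r: "awalk (pos u) r (pos v)" "real (length r) = \<bar>real (pos u) - real (pos v)\<bar>"
    using spine_awalk[OF pos_le pos_le] by blast
  have "awalk (pos v) (rev_path q) v" using q(1) by simp
  then have "awalk u (p @ r @ rev_path q) v"
    by (intro awalk_appendI[OF p(1)] awalk_appendI[OF r(1)])
  moreover have "length (p @ r @ rev_path q) \<le> D"
    using p(2) q(2) r(2) foot[of u] foot[of v] by (auto simp: pos_def length_rev_path split: if_splits)
  ultimately show ?thesis by blast
qed

lemma connected_graph: "Digraph_Component.connected (with_proj graph)"
proof -
  have "strongly_connected (with_proj graph)"
    using awalk_le_D D_less by (intro strongly_connectedI) (auto simp: reachable_awalk)
  then show ?thesis
    unfolding connected_def strongly_connected_def by (simp add: reachable_mk_symmetric_eq sym_arcs)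
qed

text \<open>An arc raises \<open>pos\<close> by at most 1. Hence a walk from \<open>0\<close> to
  \<open>D\<close> has at least \<open>D\<close> arcs, which bounds the diameter from below.\<close>

lemma pos_lipschitz:
  assumes "awalk u p v"
  shows "pos v \<le> pos u + length p"
  using assms
proof (induct p arbitrary: u)
  case Nil
  then show ?case by (simp add: awalk_simps)
next
  case (Cons e p)
  then have e: "e \<in> parcs graph" "u = fst e" and "pos v \<le> pos (snd e) + length p"
    by (auto simp: awalk_simps)
  moreover have "pos (snd e) \<le> pos (fst e) + 1"
    using e(1) by (cases rule: arc_cases) (auto simp: pos_def parent_def less_imp_le foot)
  ultimately show ?case by simp
qed

lemma graph_diameter: "graph_diameter graph = D"
  unfolding graph_diameter_def
proof (rule Max_eqI[OF finite_graph_dists])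
  fix d assume "d \<in> {graph_dist graph u v |u v. u \<in> pverts graph \<and> v \<in> pverts graph}"
  then obtain u v where "u < n" "v < n" "d = graph_dist graph u v" by auto
  then show "d \<le> D" using awalk_le_D graph_dist_le le_trans by metis
next
  obtain p where p: "awalk 0 p D" "length p \<le> D" using awalk_le_D D_less by force
  then obtain q where q: "apath 0 q D" using awalk_shorten by blast
  obtain r where r: "apath 0 r D" "length r = graph_dist graph 0 D"
    using graph_dist_apath[OF q] .
  have "D \<le> graph_dist graph 0 D"
    using pos_lipschitz[of 0 r D] r by (simp add: apath_def pos_def)
  moreover have "graph_dist graph 0 D \<le> D" using graph_dist_le[OF p(1)] p(2) by simp
  ultimately show "D \<in> {graph_dist graph u v |u v. u \<in> pverts graph \<and> v \<in> pverts graph}"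
    using D_less by force
qed

section \<open>Branches as cuts of the caterpillar\<close>

lemma branch_subset: "v < n \<Longrightarrow> branch v \<subseteq> {..<n}"
  by (auto simp: branch_def)

lemma branch_self: "v < n \<Longrightarrow> v \<in> branch v"
  by (auto simp: branch_def pos_def)

lemma parent_notin_branch: "0 < v \<Longrightarrow> parent v \<notin> branch v"
  using foot[of v] by (auto simp: branch_def pos_def parent_def)

lemma branch_exit:
  assumes "0 < w" "w < n" "w \<in> branch v" "parent w \<notin> branch v"
  shows "w = v"
  using assms foot[of w] by (auto simp: branch_def pos_def parent_def split: if_splits)

lemma branch_enter:
  assumes "0 < w" "w < n" "parent w \<in> branch v"
  shows "w \<in> branch v"
  using assms foot[of w] by (auto simp: branch_def pos_def parent_def split: if_splits)

text \<open>Towards the root, a branch is left only at its top \<open>v\<close>; away from the root,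
  it is never left.\<close>

lemma branch_crossing:
  assumes "(a, b) \<in> parcs graph" "a \<in> branch v" "b \<notin> branch v"
  shows "(a, b) = (v, parent v)"
  using assms(1)
proof (cases rule: arc_cases)
  case (up w)
  then show ?thesis using branch_exit[of w v] assms by simp
next
  case (down w)
  then show ?thesis using branch_enter[of w v] assms by simp
qed

sublocale edge_cuts graph side
proof unfold_locales
  show "Digraph_Component.connected (with_proj graph)" by (rule connected_graph)
  show "side e \<subseteq> pverts graph" "fst e \<in> side e" "snd e \<notin> side e" if e: "e \<in> parcs graph" for e
    using e by (cases rule: arc_cases;
      force simp: side_def parent_less less_imp_not_less branch_self parent_notin_branch
        dest: branch_subset parent_less intro: less_trans)+
  show "(a, b) = e" if e: "e \<in> parcs graph" and ab: "(a, b) \<in> parcs graph" "a \<in> side e" "b \<notin> side e"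
    for e a b
    using e
  proof (cases rule: arc_cases)
    case (up v)
    then show ?thesis using branch_crossing[OF ab(1), of v] ab parent_less[of v] by (simp add: side_def)
  next
    case (down v)
    \<comment> \<open>The side is now the complement of a branch, so it is the reverse of
      \<open>(a, b)\<close> that leaves the branch.\<close>
    then have "side e = {..<n} - branch v" using parent_less[of v] by (simp add: side_def)
    then have "(b, a) = (v, parent v)"
      using branch_crossing[of b a v] ab arcs_symmetric[OF ab(1)] in_arcsD2[OF ab(1)] by auto
    then show ?thesis using down by simp
  qed
qed

text \<open>The two orientations of an edge have complementary sides and hence equal weights, so
  comparing branches suffices.\<close>

lemma l1_fiedler_branch:
  assumes "0 < v" "v < n"
    and max: "\<And>w. 0 < w \<Longrightarrow> w < n \<Longrightarrow>
      real (card (branch w)) * (real n - real (card (branch w)))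
        \<le> real (card (branch v)) * (real n - real (card (branch v)))"
  shows "l1_fiedler graph = real n / (2 * (real (card (branch v)) * (real n - real (card (branch v)))))"
proof -
  have side_up: "side (w, parent w) = branch w" if "0 < w" for w
    using parent_less[OF that] by (simp add: side_def)
  have side_down: "real (card (side (parent w, w))) = real n - real (card (branch w))"
    if "0 < w" "w < n" for w
    using parent_less[OF that(1)] branch_subset[OF that(2)] card_mono[OF _ branch_subset[OF that(2)]]
    by (simp add: side_def card_Diff_subset finite_subset of_nat_diff)
  have "weight e \<le> weight (v, parent v)" if "e \<in> parcs graph" for e
    using that
  proof (cases rule: arc_cases)
    case (up w)
    then show ?thesis using max \<open>0 < v\<close> by (simp add: side_up)
  next
    case (down w)
    then show ?thesis using max[of w] \<open>0 < v\<close> by (simp add: side_up side_down mult.commute)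
  qed
  then show ?thesis
    using l1_fiedler_eq[OF arcs_graph(1)[OF assms(1,2)]] side_up[OF assms(1)] by simp
qed

end

section \<open>Sharpness of both bounds\<close>

lemma exists_tree_lower_bound:
  assumes "D \<ge> 3" "D < n"
  shows "\<exists>T :: nat pair_pre_digraph.
    tree_graph T \<and> card (pverts T) = n \<and> graph_diameter T = D \<and>
    l1_fiedler T = real n / (2 * of_int \<lceil>real n / 2\<rceil> * of_int \<lfloor>real n / 2\<rfloor>)"
proof -
  define k m where "k = (D + 1) div 2" and "m = n - n div 2"
  \<comment> \<open>The branch of \<open>k\<close> consists of \<open>k, ..., D\<close> and the
    pendant vertices below \<open>k + m\<close>, attached to \<open>D - 1\<close>; the others hang
    at \<open>1\<close>. It has \<open>m\<close> vertices in all, since \<open>D \<ge> 3\<close>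
    ensures \<open>1 < k\<close> and \<open>k \<le> D - 1\<close>.\<close>
  define c where "c v = (if v < k + m then D - 1 else 1)" for v
  interpret caterpillar n D c
    using assms by unfold_locales (auto simp: c_def)
  have k: "0 < k" "k \<le> D" "2 \<le> k" "k \<le> D - 1" "k + m \<le> n" "D < k + m"
    using assms unfolding k_def m_def by linarith+
  have "branch k = {k..<k + m}"
    using k foot by (auto simp: branch_def pos_def c_def split: if_splits)
  then have m: "real (card (branch k)) = real n - real (n div 2)" by (simp add: m_def of_nat_diff)
  have "card (branch w) \<le> n" if "w < n" for w
    using card_mono[OF _ branch_subset[OF that]] by simp
  then have "l1_fiedler graph = real n / (2 * (real (n div 2) * (real n - real (n div 2))))"
    using l1_fiedler_branch[of k] k assms(2) mult_diff_le_half by (simp add: m mult.commute)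
  then show ?thesis
    unfolding half_mult_half using tree_graph graph_diameter by (intro exI[of _ graph]) simp
qed

text \<open>With all pendant vertices at \<open>k\<close>, every edge has at most \<open>k\<close>
  vertices on its smaller side, and the edge from \<open>k\<close> to its parent has exactly
  \<open>k\<close> there.\<close>

lemma exists_tree_upper_bound:
  assumes "D \<ge> 2" "D < n"
  shows "\<exists>T :: nat pair_pre_digraph.
    tree_graph T \<and> card (pverts T) = n \<and> graph_diameter T = D \<and>
    l1_fiedler T = real n / (2 * of_int \<lceil>real D / 2\<rceil> * (real n - of_int \<lceil>real D / 2\<rceil>))"
proof -
  define k where "k = (D + 1) div 2"
  interpret caterpillar n D "\<lambda>_. k"
    using assms by unfold_locales (auto simp: k_def)
  have k: "0 < k" "k < D" "2 * k \<le> n" "D + 1 \<le> 2 * k + 1"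
    using assms unfolding k_def by linarith+
  have lower: "branch w = {w..<n}" if "w \<le> k" for w
    using k that assms by (auto simp: branch_def pos_def)
  have upper: "branch w = {w..D}" if "k < w" "w \<le> D" for w
    using k that assms by (auto simp: branch_def pos_def split: if_splits)
  have leaf: "branch w = {w}" if "D < w" for w
    using that by (simp add: branch_def)
  have cut: "real (card (branch k)) * (real n - real (card (branch k))) = real k * (real n - real k)"
    using k by (simp add: lower of_nat_diff)
  have "real (card (branch w)) * (real n - real (card (branch w))) \<le> real k * (real n - real k)"
    if w: "0 < w" "w < n" for w
  proof -
    consider "w \<le> k" | "k < w" "w \<le> D" | "D < w" by linarith
    then show ?thesis
    proof cases
      case 1
      then have "real w * (real n - real w) \<le> real k * (real n - real k)"
        using k by (intro mult_diff_mono) auto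
      then show ?thesis using w by (simp add: lower[OF 1] of_nat_diff mult.commute)
    next
      case 2
      \<comment> \<open>The branch has \<open>D + 1 - w\<close> vertices, which is at most
        \<open>D - k\<close> and hence at most \<open>k\<close>.\<close>
      then show ?thesis using k by (intro mult_diff_mono) (auto simp: upper)
    next
      case 3
      then show ?thesis using k by (intro mult_diff_mono) (auto simp: leaf)
    qed
  qed
  then have "l1_fiedler graph = real n / (2 * (real k * (real n - real k)))"
    using l1_fiedler_branch[of k] k assms(2) cut by simp
  then show ?thesis
    unfolding ceiling_half k_def[symmetric] using tree_graph graph_diameter
    by (intro exI[of _ graph]) (simp add: mult.assoc)
qed

text \<open>A tree of diameter \<open>D\<close> has at least \<open>D + 1\<close> vertices, so
  sharpness is shown for every possible \<open>n\<close>.\<close>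

theorem theorem4p3:
  fixes n D :: nat
  assumes "D \<ge> 3"
  shows
    "(\<forall>T :: 'a pair_pre_digraph.
        tree_graph T \<and> card (pverts T) = n \<and> graph_diameter T = D \<longrightarrow>
          real n / (2 * of_int \<lceil>real n / 2\<rceil> * of_int \<lfloor>real n / 2\<rfloor>) \<le> l1_fiedler T \<and>
          l1_fiedler T \<le> real n / (2 * of_int \<lceil>real D / 2\<rceil> * (real n - of_int \<lceil>real D / 2\<rceil>)))
     \<and>
     (n \<ge> D + 1 \<longrightarrow>
        (\<exists>T :: nat pair_pre_digraph.
           tree_graph T \<and> card (pverts T) = n \<and> graph_diameter T = D \<and>
           l1_fiedler T = real n / (2 * of_int \<lceil>real n / 2\<rceil> * of_int \<lfloor>real n / 2\<rfloor>)) \<and>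
        (\<exists>T :: nat pair_pre_digraph.
           tree_graph T \<and> card (pverts T) = n \<and> graph_diameter T = D \<and>
           l1_fiedler T = real n / (2 * of_int \<lceil>real D / 2\<rceil> * (real n - of_int \<lceil>real D / 2\<rceil>))))"
proof (intro conjI allI impI)
  fix T :: "'a pair_pre_digraph"
  assume "tree_graph T \<and> card (pverts T) = n \<and> graph_diameter T = D"
  with assms show "real n / (2 * of_int \<lceil>real n / 2\<rceil> * of_int \<lfloor>real n / 2\<rfloor>) \<le> l1_fiedler T"
    and "l1_fiedler T \<le> real n / (2 * of_int \<lceil>real D / 2\<rceil> * (real n - of_int \<lceil>real D / 2\<rceil>))"
    using l1_fiedler_tree_bounds[of T n D] by auto
qed (use assms exists_tree_lower_bound[of D n] exists_tree_upper_bound[of D n] in auto)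

end
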